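(* Let $\{(\mathbb{X}_i,\Gamma_i/{\sim_i})\}_{i\in I}$ be a set-indexed collection of objects of the category $\mathbf{X}$ of triples. Define $\mathbb{X}=\prod_{i\in I}\mathbb{X}_i$ with projections $\pi_i$; let $\Gamma$ be the set of functions $\gamma:[0,1]\to\mathbb{X}$ with $\pi_i\circ\gamma\in\Gamma_i$ for each $i\in I$; and for $\gamma,\gamma'\in\Gamma$ put $\gamma\sim\gamma'$ if $\pi_i\circ\gamma\sim_i\pi_i\circ\gamma'$ for each $i\in I$. Then $(\mathbb{X},\Gamma/{\sim})$ (is an object of $\mathbf{X}$ and) is the product of the $(\mathbb{X}_i,\Gamma_i/{\sim_i})$ in $\mathbf{X}$.
   Context: A path in a nonempty set $\mathbb{X}$ is any function $\gamma:[0,1]\to\mathbb{X}$. If $\gamma(1)=\gamma'(0)$, then $\gamma\cdot\gamma'$ is the path equal to $\gamma(2t)$ for $0\le t\le\frac12$ and to $\gamma'(2t-1)$ for $\frac12\le t\le1$. A triple $(\mathbb{X},\Gamma/{\sim})$ consists of a nonempty set $\mathbb{X}$, a set $\Gamma$ of paths in $\mathbb{X}$, and an equivalence relation $\sim$ on $\Gamma$ (equivalent paths have the same endpoints) such that: (a) $\gamma,\gamma'\in\Gamma$ with $\gamma(1)=\gamma'(0)$ implies $\gamma\cdot\gamma'\in\Gamma$; (b) if $\gamma\in\Gamma$ and $\phi:[0,1]\to[0,1]$ is weakly order preserving and sends intervals to intervals, then $\gamma\circ\phi\in\Gamma$; (c) all constant paths are in $\Gamma$; (d) a path equivalent to a constant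 path is constant; (e) if in (b) also $\phi(0)=0$, $\phi(1)=1$, then $\gamma\sim\gamma\circ\phi$; (f) if $\gamma,\gamma',\rho,\rho'\in\Gamma$ and $\rho\cdot\gamma\cdot\rho'$, $\rho\cdot\gamma'\cdot\rho'$ are defined and in $\Gamma$, then $\gamma\sim\gamma'$ if and only if $\rho\cdot\gamma\cdot\rho'\sim\rho\cdot\gamma'\cdot\rho'$. The category $\mathbf{X}$ has triples as objects; a morphism $(\mathbb{X}_1,\Gamma_1/{\sim_1})\to(\mathbb{X}_2,\Gamma_2/{\sim_2})$ is a function $f:\mathbb{X}_1\to\mathbb{X}_2$ such that $f\circ\gamma\in\Gamma_2$ for all $\gamma\in\Gamma_1$, and $\gamma\sim_1\gamma'$ implies $f\circ\gamma\sim_2f\circ\gamma'$. *)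

theory Defs
  imports "HOL-Analysis.Analysis"
begin

text \<open>
  Functions between sets are extensional functions: a path in \<open>X\<close> is an element of
  \<open>{0..1} \<rightarrow>\<^sub>E X\<close> and composition is \<^const>\<open>compose\<close>, so that equality
  of functions on their domain is equality in HOL.
\<close>

record 'a triple =
  points :: "'a set"
  paths :: "(real \<Rightarrow> 'a) set"
  path_equiv :: "((real \<Rightarrow> 'a) \<times> (real \<Rightarrow> 'a)) set"

definition const_path :: "'a \<Rightarrow> real \<Rightarrow> 'a"
  where "const_path x = (\<lambda>t\<in>{0..1}. x)"

text \<open>
  Concatenation of paths is meaningful under \<open>g 1 = h 0\<close> only. The library's \<open>+++\<close> is given by
  the same formula, but requires a topological codomain.
\<close>

definition concat_path :: "(real \<Rightarrow> 'a) \<Rightarrow> (real \<Rightarrow> 'a) \<Rightarrow> real \<Rightarrow> 'a"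
  where "concat_path g h = (\<lambda>t\<in>{0..1}. if t \<le> 1/2 then g (2 * t) else h (2 * t - 1))"

definition reparam :: "(real \<Rightarrow> real) \<Rightarrow> bool"
  where "reparam \<phi> \<longleftrightarrow> \<phi> \<in> {0..1} \<rightarrow> {0..1} \<and> mono_on {0..1} \<phi> \<and>
    (\<forall>J. J \<subseteq> {0..1} \<and> is_interval J \<longrightarrow> is_interval (\<phi> ` J))"

text \<open>
  In \<open>concat_cancel\<close> the threefold concatenation is bracketed to the left; by \<open>equiv_reparam\<close>
  the two bracketings are equivalent.
\<close>

locale path_triple =
  fixes T :: "'a triple"
  assumes nonempty: "points T \<noteq> {}"
    and paths_in: "paths T \<subseteq> {0..1} \<rightarrow>\<^sub>E points T"
    and equiv_paths: "equiv (paths T) (path_equiv T)"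
    and equiv_endpoints: "(g, h) \<in> path_equiv T \<Longrightarrow> g 0 = h 0 \<and> g 1 = h 1"
    and concat_closed: "\<lbrakk>g \<in> paths T; h \<in> paths T; g 1 = h 0\<rbrakk> \<Longrightarrow> concat_path g h \<in> paths T"
    and reparam_closed: "\<lbrakk>g \<in> paths T; reparam \<phi>\<rbrakk> \<Longrightarrow> compose {0..1} g \<phi> \<in> paths T"
    and const_closed: "x \<in> points T \<Longrightarrow> const_path x \<in> paths T"
    and equiv_const:
      "\<lbrakk>x \<in> points T; (g, const_path x) \<in> path_equiv T\<rbrakk> \<Longrightarrow> \<exists>y\<in>points T. g = const_path y"
    and equiv_reparam: "\<lbrakk>g \<in> paths T; reparam \<phi>; \<phi> 0 = 0; \<phi> 1 = 1\<rbrakk>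
      \<Longrightarrow> (g, compose {0..1} g \<phi>) \<in> path_equiv T"
    and concat_cancel: "\<lbrakk>g \<in> paths T; h \<in> paths T; r \<in> paths T; s \<in> paths T;
        r 1 = g 0; g 1 = s 0; r 1 = h 0; h 1 = s 0;
        concat_path (concat_path r g) s \<in> paths T; concat_path (concat_path r h) s \<in> paths T\<rbrakk>
      \<Longrightarrow> (g, h) \<in> path_equiv T \<longleftrightarrow>
        (concat_path (concat_path r g) s, concat_path (concat_path r h) s) \<in> path_equiv T"

definition triple_morphism :: "'a triple \<Rightarrow> 'b triple \<Rightarrow> ('a \<Rightarrow> 'b) \<Rightarrow> bool"
  where "triple_morphism S T f \<longleftrightarrow> f \<in> points S \<rightarrow>\<^sub>E points T \<and>
    (\<forall>g\<in>paths S. compose {0..1} f g \<in> paths T) \<and>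
    (\<forall>g h. (g, h) \<in> path_equiv S \<longrightarrow> (compose {0..1} f g, compose {0..1} f h) \<in> path_equiv T)"

text \<open>
  The categorical product of the objects \<open>A i\<close>, \<open>i \<in> I\<close>. HOL cannot quantify over types inside a
  formula, so the type of the points of the test objects is a parameter; a statement that leaves
  it a type variable covers test objects over every type.
\<close>

definition is_product ::
  "'c itself \<Rightarrow> 'i set \<Rightarrow> ('i \<Rightarrow> 'a triple) \<Rightarrow> 'b triple \<Rightarrow> ('i \<Rightarrow> 'b \<Rightarrow> 'a) \<Rightarrow> bool"
  where "is_product _ I A P p \<longleftrightarrow>
    path_triple P \<and> (\<forall>i\<in>I. triple_morphism P (A i) (p i)) \<and>
    (\<forall>(Y :: 'c triple) f. path_triple Y \<and> (\<forall>i\<in>I. triple_morphism Y (A i) (f i)) \<longrightarrow>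
      (\<exists>!h. triple_morphism Y P h \<and> (\<forall>i\<in>I. compose (points Y) (p i) h = f i)))"

definition proj :: "'i set \<Rightarrow> ('i \<Rightarrow> 'a triple) \<Rightarrow> 'i \<Rightarrow> ('i \<Rightarrow> 'a) \<Rightarrow> 'a"
  where "proj I A i = (\<lambda>x\<in>(\<Pi>\<^sub>E j\<in>I. points (A j)). x i)"

definition product_paths :: "'i set \<Rightarrow> ('i \<Rightarrow> 'a triple) \<Rightarrow> (real \<Rightarrow> 'i \<Rightarrow> 'a) set"
  where "product_paths I A = {g \<in> {0..1} \<rightarrow>\<^sub>E (\<Pi>\<^sub>E i\<in>I. points (A i)).
    \<forall>i\<in>I. compose {0..1} (proj I A i) g \<in> paths (A i)}"

definition product_triple :: "'i set \<Rightarrow> ('i \<Rightarrow> 'a triple) \<Rightarrow> ('i \<Rightarrow> 'a) triple"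
  where "product_triple I A =
    \<lparr>points = (\<Pi>\<^sub>E i\<in>I. points (A i)),
     paths = product_paths I A,
     path_equiv = {(g, h). g \<in> product_paths I A \<and> h \<in> product_paths I A \<and>
       (\<forall>i\<in>I. (compose {0..1} (proj I A i) g, compose {0..1} (proj I A i) h)
         \<in> path_equiv (A i))}\<rparr>"

end

theory Submission
  imports Defs
begin

text \<open>Paths, their equivalence and the points of the product are all defined coordinate by
  coordinate, and composing with a projection commutes with the operations on paths: concatenation,
  constant paths and reparametrization (\<open>compose_concat_path\<close>,
  \<open>compose_const_path\<close>, \<open>compose_compose_reparam\<close>). Hence each axiom for
  the product follows by applying the same axiom in every factor and collecting the results over
  \<open>I\<close>. Two axioms need slightly more: nonemptiness is a choice of points, and a path
  equivalent to a constant one is constant in each coordinate separately, so the constants have to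
  be assembled into one point.

  For the universal property the mediating map can only be \<open>y\<close> \<mapsto> the family of
  all \<open>f i y\<close>. It is a morphism because its composite with a path \<open>g\<close> has
  the coordinates \<open>f i\<close> composed with \<open>g\<close>, which each \<open>f i\<close>
  controls. Points and functions are extensional, so agreement of coordinates gives equality
  (\<open>PiE_fun_eqI\<close>).\<close>

lemma compose_concat_path:
  "compose {0..1} f (concat_path g h) = concat_path (compose {0..1} f g) (compose {0..1} f h)"
  by (rule ext) (auto simp: compose_def concat_path_def)

lemma compose_const_path: "compose {0..1} f (const_path x) = const_path (f x)"
  by (rule ext) (auto simp: compose_def const_path_def)

lemma compose_compose_reparam:
  "reparam \<phi> \<Longrightarrow> compose {0..1} f (compose {0..1} g \<phi>) = compose {0..1} (compose {0..1} f g) \<phi>"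
  by (rule compose_assoc[where B = "{0..1}"]) (simp add: reparam_def)

lemma concat_path_funcset:
  "g \<in> {0..1} \<rightarrow>\<^sub>E X \<Longrightarrow> h \<in> {0..1} \<rightarrow>\<^sub>E X \<Longrightarrow> concat_path g h \<in> {0..1} \<rightarrow>\<^sub>E X"
  by (auto simp: concat_path_def PiE_iff)

lemma compose_reparam_funcset:
  "g \<in> {0..1} \<rightarrow>\<^sub>E X \<Longrightarrow> reparam \<phi> \<Longrightarrow> compose {0..1} g \<phi> \<in> {0..1} \<rightarrow>\<^sub>E X"
  by (auto simp: compose_def reparam_def PiE_iff Pi_iff)

lemma const_path_funcset: "x \<in> X \<Longrightarrow> const_path x \<in> {0..1} \<rightarrow>\<^sub>E X"
  by (auto simp: const_path_def)

text \<open>The map \<open>proj I A i\<close> is cut off outside the product set, so reading off a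
  coordinate requires \<open>g\<close> to take its values there.\<close>

lemma proj_compose_apply:
  assumes "g \<in> {0..1} \<rightarrow>\<^sub>E (\<Pi>\<^sub>E i\<in>I. points (A i))" and "t \<in> {0..1}"
  shows "compose {0..1} (proj I A i) g t = g t i"
  using assms PiE_mem[OF assms] by (simp add: compose_def proj_def)

lemma product_pathsD:
  assumes "g \<in> product_paths I A"
  shows "g \<in> {0..1} \<rightarrow>\<^sub>E (\<Pi>\<^sub>E i\<in>I. points (A i))"
    and "i \<in> I \<Longrightarrow> compose {0..1} (proj I A i) g \<in> paths (A i)"
  using assms by (auto simp: product_paths_def)

text \<open>Extensionality at two levels, in the argument and in the index. It identifies constant
  paths in the product and gives uniqueness of the mediating map.\<close>

lemma PiE_fun_eqI:
  assumes "g \<in> S \<rightarrow>\<^sub>E (\<Pi>\<^sub>E i\<in>I. X i)" and "h \<in> S \<rightarrow>\<^sub>E (\<Pi>\<^sub>E i\<in>I. X i)"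
    and "\<And>t i. t \<in> S \<Longrightarrow> i \<in> I \<Longrightarrow> g t i = h t i"
  shows "g = h"
proof (rule PiE_ext[OF assms(1,2)])
  fix t assume t: "t \<in> S"
  show "g t = h t"
    using PiE_mem[OF assms(1) t] PiE_mem[OF assms(2) t] assms(3)[OF t] by (rule PiE_ext)
qed

lemma path_triple_product_triple:
  fixes A :: "'i \<Rightarrow> 'a triple"
  assumes A: "\<And>i. i \<in> I \<Longrightarrow> path_triple (A i)"
  shows "path_triple (product_triple I A)"
proof -
  let ?P = "product_triple I A"
  let ?X = "\<Pi>\<^sub>E i\<in>I. points (A i)"
  let ?q = "\<lambda>i. compose {0..1} (proj I A i)"
  have pts: "points ?P = ?X" and paths: "paths ?P = product_paths I A"
    by (simp_all add: product_triple_def)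
  have eqv: "(g, h) \<in> path_equiv ?P \<longleftrightarrow> g \<in> product_paths I A \<and> h \<in> product_paths I A \<and>
      (\<forall>i\<in>I. (?q i g, ?q i h) \<in> path_equiv (A i))" for g h
    by (simp add: product_triple_def)
  have endp: "?q i g 0 = g 0 i \<and> ?q i g 1 = g 1 i" if "g \<in> product_paths I A" for g i
    using proj_compose_apply[OF product_pathsD(1)[OF that]] by simp
  \<comment> \<open>Composability passes to each coordinate, which is what the concatenation axioms
    of the factors ask for.\<close>
  have q_match: "?q i g 1 = ?q i h 0"
    if "g \<in> product_paths I A" "h \<in> product_paths I A" "g 1 = h 0" for g h i
    using endp that by metis
  have concat: "concat_path g h \<in> product_paths I A"
    if g: "g \<in> product_paths I A" and h: "h \<in> product_paths I A" and gh: "g 1 = h 0" for g h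
    using concat_path_funcset[OF g[THEN product_pathsD(1)] h[THEN product_pathsD(1)]]
      path_triple.concat_closed[OF A g[THEN product_pathsD(2)] h[THEN product_pathsD(2)]]
      q_match[OF g h gh]
    by (simp add: product_paths_def compose_concat_path)
  have repar: "compose {0..1} g \<phi> \<in> product_paths I A"
    if g: "g \<in> product_paths I A" and \<phi>: "reparam \<phi>" for g \<phi>
    using compose_reparam_funcset[OF g[THEN product_pathsD(1)] \<phi>]
      path_triple.reparam_closed[OF A g[THEN product_pathsD(2)] \<phi>]
    by (simp add: product_paths_def compose_compose_reparam[OF \<phi>])
  show ?thesis
  proof
    \<comment> \<open>This is the axiom of choice, contained in
      \<open>PiE_eq_empty_iff\<close>.\<close>
    show "points ?P \<noteq> {}"
      using A[THEN path_triple.nonempty] by (simp add: pts PiE_eq_empty_iff)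
    show "paths ?P \<subseteq> {0..1} \<rightarrow>\<^sub>E points ?P"
      unfolding pts paths using product_pathsD(1) by blast
    have eqA: "refl_on (paths (A i)) (path_equiv (A i))" "sym (path_equiv (A i))"
      "trans (path_equiv (A i))" if "i \<in> I" for i
      using A[THEN path_triple.equiv_paths, OF that] by (auto elim: equivE)
    show "equiv (paths ?P) (path_equiv ?P)"
    proof (rule equivI)
      show "path_equiv ?P \<subseteq> paths ?P \<times> paths ?P" by (auto simp: eqv paths)
      show "refl_on (paths ?P) (path_equiv ?P)"
        by (auto simp: refl_on_def eqv paths intro: refl_onD[OF eqA(1)] product_pathsD(2))
      show "sym (path_equiv ?P)"
        by (rule symI) (auto simp: eqv intro: symD[OF eqA(2)])
      show "trans (path_equiv ?P)"
        by (rule transI) (auto simp: eqv intro: transD[OF eqA(3)])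
    qed
    show "g 0 = h 0 \<and> g 1 = h 1" if gh: "(g, h) \<in> path_equiv ?P" for g h
    proof -
      have g: "g \<in> product_paths I A" and h: "h \<in> product_paths I A" using gh by (auto simp: eqv)
      have *: "g 0 i = h 0 i \<and> g 1 i = h 1 i" if "i \<in> I" for i
        using path_triple.equiv_endpoints[OF A[OF that], of "?q i g" "?q i h"] gh that
          endp[OF g, of i] endp[OF h, of i] by (simp add: eqv)
      \<comment> \<open>Coordinates in \<open>I\<close> determine a point only among extensional
        families, so membership in the product is needed before concluding from
        \<open>*\<close>.\<close>
      have "g t \<in> ?X" "h t \<in> ?X" if "t \<in> {0..1}" for t
        using that g h product_pathsD(1) PiE_mem by blast+
      then have "g 0 \<in> ?X" "h 0 \<in> ?X" "g 1 \<in> ?X" "h 1 \<in> ?X" by auto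
      then show ?thesis
        using PiE_ext[of "g 0" I _ "h 0"] PiE_ext[of "g 1" I _ "h 1"] * by blast
    qed
    show "concat_path g h \<in> paths ?P" if "g \<in> paths ?P" "h \<in> paths ?P" "g 1 = h 0" for g h
      using that concat by (simp add: paths)
    show "compose {0..1} g \<phi> \<in> paths ?P" if "g \<in> paths ?P" "reparam \<phi>" for g \<phi>
      using that repar by (simp add: paths)
    show "const_path x \<in> paths ?P" if "x \<in> points ?P" for x
      using that const_path_funcset[of x ?X]
      by (auto simp: pts paths product_paths_def compose_const_path proj_def
          intro!: path_triple.const_closed[OF A])
    show "\<exists>y\<in>points ?P. g = const_path y"
      if x: "x \<in> points ?P" and gx: "(g, const_path x) \<in> path_equiv ?P" for g x
    proof -
      have g: "g \<in> product_paths I A" using gx by (simp add: eqv)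
      note gX = product_pathsD(1)[OF g]
      have g0: "g 0 \<in> ?X" using gX PiE_mem[of g "{0..1}" _ 0] by auto
      \<comment> \<open>The constant \<open>y\<close> supplied by the factor depends on
        \<open>i\<close>. Evaluating at time 0 identifies it as \<open>g 0 i\<close>, so
        \<open>g 0\<close> is the common constant point and no choice over \<open>i\<close> is
        made.\<close>
      have "g t i = const_path (g 0) t i" if t: "t \<in> {0..1}" and i: "i \<in> I" for t i
      proof -
        have "(?q i g, const_path (x i)) \<in> path_equiv (A i)" "x i \<in> points (A i)"
          using gx x i by (auto simp: eqv pts compose_const_path proj_def)
        then obtain y where "?q i g = const_path y"
          using path_triple.equiv_const[OF A[OF i]] by blast
        then have "g s i = y" if "s \<in> {0..1}" for s
          using proj_compose_apply[OF gX that, of i] that by (simp add: const_path_def)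
        then show ?thesis using t by (simp add: const_path_def)
      qed
      then have "g = const_path (g 0)"
        by (rule PiE_fun_eqI[OF gX const_path_funcset[OF g0]])
      then show ?thesis using g0 pts by blast
    qed
    show "(g, compose {0..1} g \<phi>) \<in> path_equiv ?P"
      if g: "g \<in> paths ?P" and \<phi>: "reparam \<phi>" "\<phi> 0 = 0" "\<phi> 1 = 1" for g \<phi>
      using g repar[OF _ \<phi>(1)] path_triple.equiv_reparam[OF A product_pathsD(2)[OF g[unfolded paths]] \<phi>]
      by (simp add: eqv paths compose_compose_reparam[OF \<phi>(1)])
    show "(g, h) \<in> path_equiv ?P \<longleftrightarrow>
        (concat_path (concat_path r g) s, concat_path (concat_path r h) s) \<in> path_equiv ?P"
      if m: "g \<in> paths ?P" "h \<in> paths ?P" "r \<in> paths ?P" "s \<in> paths ?P"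
        and e: "r 1 = g 0" "g 1 = s 0" "r 1 = h 0" "h 1 = s 0"
        and c: "concat_path (concat_path r g) s \<in> paths ?P"
          "concat_path (concat_path r h) s \<in> paths ?P"
      for g h r s
    proof -
      note m' = m[unfolded paths] and c' = c[unfolded paths]
      \<comment> \<open>Cancellation holds as an equivalence in every factor, so it survives the
        conjunction over \<open>I\<close>.\<close>
      have "(?q i g, ?q i h) \<in> path_equiv (A i) \<longleftrightarrow>
          (?q i (concat_path (concat_path r g) s), ?q i (concat_path (concat_path r h) s))
            \<in> path_equiv (A i)" if i: "i \<in> I" for i
        unfolding compose_concat_path
        by (rule path_triple.concat_cancel[OF A[OF i] m'[THEN product_pathsD(2), OF i]])
          (use c'[THEN product_pathsD(2), OF i] in \<open>auto simp: compose_concat_path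
            intro!: q_match m' e\<close>)
      then show ?thesis using m' c' by (simp add: eqv)
    qed
  qed
qed

text \<open>The paths and the equivalence of the product are defined by exactly the conditions that
  make each projection preserve them.\<close>

lemma triple_morphism_proj:
  assumes "i \<in> I"
  shows "triple_morphism (product_triple I A) (A i) (proj I A i)"
proof -
  have "proj I A i \<in> (\<Pi>\<^sub>E i\<in>I. points (A i)) \<rightarrow>\<^sub>E points (A i)"
    using assms by (auto simp: proj_def)
  then show ?thesis
    using assms by (simp add: triple_morphism_def product_triple_def product_pathsD(2))
qed

lemma is_product_product_triple:
  fixes A :: "'i \<Rightarrow> 'a triple"
  assumes A: "\<And>i. i \<in> I \<Longrightarrow> path_triple (A i)"
  shows "is_product TYPE('c) I A (product_triple I A) (proj I A)"
  unfolding is_product_def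
proof (intro conjI allI ballI impI)
  let ?P = "product_triple I A"
  let ?X = "\<Pi>\<^sub>E i\<in>I. points (A i)"
  show "path_triple ?P" using A by (rule path_triple_product_triple)
  show "triple_morphism ?P (A i) (proj I A i)" if "i \<in> I" for i
    using that by (rule triple_morphism_proj)
  fix Y :: "'c triple" and f
  assume "path_triple Y \<and> (\<forall>i\<in>I. triple_morphism Y (A i) (f i))"
  then have Y: "path_triple Y" and f: "\<And>i. i \<in> I \<Longrightarrow> triple_morphism Y (A i) (f i)" by auto
  have fE: "f i \<in> points Y \<rightarrow>\<^sub>E points (A i)" if "i \<in> I" for i
    using f[OF that] by (simp add: triple_morphism_def)
  \<comment> \<open>The equations with the projections force this value at every point.\<close>
  define h where "h = (\<lambda>y\<in>points Y. \<lambda>i\<in>I. f i y)"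
  have hE: "h \<in> points Y \<rightarrow>\<^sub>E ?X"
    using fE by (fastforce simp: h_def)
  have YE: "g \<in> {0..1} \<rightarrow>\<^sub>E points Y" if "g \<in> paths Y" for g
    using path_triple.paths_in[OF Y] that by blast
  have proj_h: "compose (points Y) (proj I A i) h = f i" if i: "i \<in> I" for i
  proof
    fix y
    show "compose (points Y) (proj I A i) h y = f i y"
      using PiE_mem[OF hE, of y] PiE_arb[OF fE[OF i], of y] i
      by (auto simp: compose_def proj_def h_def)
  qed
  \<comment> \<open>Associativity with \<open>proj_h\<close>: the coordinates of the image path are
    governed by \<open>f i\<close>, so both morphism conditions for \<open>h\<close> reduce to those
    for the \<open>f i\<close>.\<close>
  have comp: "compose {0..1} (proj I A i) (compose {0..1} h g) = compose {0..1} (f i) g"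
    if g: "g \<in> paths Y" and i: "i \<in> I" for g i
    using compose_assoc[of g "{0..1}" "points Y" "proj I A i" h] YE[OF g] proj_h[OF i]
    by (auto simp: PiE_def)
  have paths: "compose {0..1} h g \<in> product_paths I A" if g: "g \<in> paths Y" for g
  proof -
    have "compose {0..1} h g \<in> {0..1} \<rightarrow>\<^sub>E ?X"
      using hE YE[OF g] by (auto simp: compose_def Pi_iff PiE_iff)
    then show ?thesis
      using f g comp[OF g] by (auto simp: product_paths_def triple_morphism_def)
  qed
  \<comment> \<open>Equivalence in the product includes membership in \<open>product_paths\<close>,
    so equivalent arguments must first be known to be paths.\<close>
  have equivY: "g \<in> paths Y" "g' \<in> paths Y" if "(g, g') \<in> path_equiv Y" for g g'
    using path_triple.equiv_paths[OF Y] that by (auto simp: equiv_def refl_on_def)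
  have h: "triple_morphism Y ?P h"
    unfolding triple_morphism_def product_triple_def
    using hE paths equivY comp f by (auto simp: triple_morphism_def)
  show "\<exists>!h. triple_morphism Y ?P h \<and> (\<forall>i\<in>I. compose (points Y) (proj I A i) h = f i)"
  proof (rule ex1I)
    show "triple_morphism Y ?P h \<and> (\<forall>i\<in>I. compose (points Y) (proj I A i) h = f i)"
      using h proj_h by blast
    fix k assume k: "triple_morphism Y ?P k \<and> (\<forall>i\<in>I. compose (points Y) (proj I A i) k = f i)"
    then have kE: "k \<in> points Y \<rightarrow>\<^sub>E ?X"
      by (simp add: triple_morphism_def product_triple_def)
    show "k = h"
    proof (rule PiE_fun_eqI[OF kE hE])
      fix y i assume y: "y \<in> points Y" and i: "i \<in> I"
      have "compose (points Y) (proj I A i) k y = f i y" using k i by simp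
      then show "k y i = h y i"
        using PiE_mem[OF kE y] y i by (simp add: compose_def proj_def h_def)
    qed
  qed
qed

theorem proposition1p10:
  fixes I :: "'i set" and A :: "'i \<Rightarrow> 'a triple"
  assumes "\<And>i. i \<in> I \<Longrightarrow> path_triple (A i)"
  shows "path_triple (product_triple I A) \<and>
    is_product TYPE('c) I A (product_triple I A) (proj I A)"
  by (intro conjI path_triple_product_triple is_product_product_triple assms)

end
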